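(* Let $d\ge1$. For every $\ell\ge0$, either $\mathcal U_\ell=\varnothing$ or $\mathcal U_\ell$ is the set of all finite response histories in dimension $d$, where $\mathcal U_\ell$ is the set of finite response histories $H$ from which the adversary wins the escape game at slope $\ell$ (i.e. wins from $H$ for the target $\operatorname{Esc}_{\ell,H}$).
   Context: $\|\cdot\|$ is the Euclidean norm on $\mathbb{R}^d$. A finite response history of length $n\ge0$ is $H=(x_0,\dots,x_n;r_0,\dots,r_{n-1})$ with all $x_i,r_i\in\mathbb{R}^d$ (no responses if $n=0$). Its state radius is $\operatorname{rad}(H)=\max_{0\le i\le n}\|x_i-x_0\|$. For $u,r\in\mathbb{R}^d$ the successor history is $H^+(u,r)=(x_0,\dots,x_n,u+r;r_0,\dots,r_{n-1},r)$. For $\ell\ge0$, $\operatorname{Env}_\ell(H)=0$ if $n=0$, and $\operatorname{Env}_\ell(H)=\max_{0\le i,j\le n-1}(\|r_i-r_j\|-\ell\|x_i-x_j\|)_+$ if $n\ge1$, where $q_+=\max\{q,0\}$. A play from an initial history $H^0$ is a sequence $\pi=(H^k,u_k,r_k,H^{k+1})_{k\ge0}$ with $u_k,r_k\in\mathbb{R}^d$ and $H^{k+1}=(H^k)^+(u_k,r_k)$. At stage $k$ the controller sees $H^k$ and chooses $u_k$; then the adversary sees $(H^k,u_k)$ and chooses $r_k$. A controller strategy is an arbitrary map $\mu$ from finite response histories to $\mathbb{R}^d$ ($u_k=\mu(H^k)$); an adversary strategy is an arbitrary map $\sigma$ from pairs $(H,u)$ to $\mathbb{R}^d$ ($r_k=\sigma(H^k,u_k)$).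 Let $\operatorname{Env}^\infty_\ell(\pi)=\sup_k\operatorname{Env}_\ell(H^k)$, and let $\operatorname{Esc}_{\ell,H^0}$ be the set of plays $\pi$ from $H^0$ with $\operatorname{Env}^\infty_\ell(\pi)<\infty$ and $\sup_k\operatorname{rad}(H^k)=\infty$. The adversary wins from $H^0$ for $\operatorname{Esc}_{\ell,H^0}$ if there is an adversary strategy $\sigma$ such that for every controller strategy $\mu$ the resulting play from $H^0$ lies in $\operatorname{Esc}_{\ell,H^0}$. *)

theory Defs
  imports "HOL-Analysis.Analysis"
begin

text \<open>
  A pair \<open>(xs, rs)\<close> of lists stands for \<open>(x\<^sub>0, \<dots>, x\<^sub>n; r\<^sub>0, \<dots>, r\<^sub>n\<^sub>-\<^sub>1)\<close>. Only the pairs in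
  \<open>histories\<close> are finite response histories.
\<close>

type_synonym 'd history = "(real ^ 'd) list \<times> (real ^ 'd) list"

definition histories :: "('d::finite) history set" where
  "histories = {(xs, rs). length xs = Suc (length rs)}"

definition rad :: "('d::finite) history \<Rightarrow> real" where
  "rad = (\<lambda>(xs, rs). Max ((\<lambda>i. norm (xs ! i - xs ! 0)) ` {0..length rs}))"

definition succ_history :: "('d::finite) history \<Rightarrow> (real ^ 'd) \<Rightarrow> (real ^ 'd) \<Rightarrow> 'd history" where
  "succ_history H u r = (fst H @ [u + r], snd H @ [r])"

definition Env :: "real \<Rightarrow> ('d::finite) history \<Rightarrow> real" where
  "Env l = (\<lambda>(xs, rs).
     if length rs = 0 then 0
     else Max ((\<lambda>(i, j). max (norm (rs ! i - rs ! j) - l * norm (xs ! i - xs ! j)) 0)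
                 ` ({0..<length rs} \<times> {0..<length rs})))"

type_synonym 'd play = "nat \<Rightarrow> 'd history \<times> (real ^ 'd) \<times> (real ^ 'd) \<times> 'd history"

definition history_at :: "('d::finite) play \<Rightarrow> nat \<Rightarrow> 'd history" where
  "history_at \<pi> k = fst (\<pi> k)"

definition plays_from :: "('d::finite) history \<Rightarrow> 'd play set" where
  "plays_from H0 = {\<pi>. history_at \<pi> 0 = H0 \<and>
     (\<forall>k. case \<pi> k of (H, u, r, H') \<Rightarrow>
        H' = succ_history H u r \<and> history_at \<pi> (Suc k) = H')}"

definition Env_inf :: "real \<Rightarrow> ('d::finite) play \<Rightarrow> ereal" where
  "Env_inf l \<pi> = (SUP k. ereal (Env l (history_at \<pi> k)))"

definition Esc :: "real \<Rightarrow> ('d::finite) history \<Rightarrow> 'd play set" where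
  "Esc l H0 = {\<pi> \<in> plays_from H0.
     Env_inf l \<pi> < \<infinity> \<and> (SUP k. ereal (rad (history_at \<pi> k))) = \<infinity>}"

text \<open>
  Strategies are total functions on pairs of lists. Their values outside \<open>histories\<close> are never
  used, because a play from a history stays in \<open>histories\<close>.
\<close>

type_synonym 'd controller = "'d history \<Rightarrow> (real ^ 'd)"
type_synonym 'd adversary = "'d history \<Rightarrow> (real ^ 'd) \<Rightarrow> (real ^ 'd)"

primrec run :: "('d::finite) controller \<Rightarrow> 'd adversary \<Rightarrow> 'd history \<Rightarrow> nat \<Rightarrow> 'd history" where
  "run \<mu> \<sigma> H0 0 = H0"
| "run \<mu> \<sigma> H0 (Suc k) =
     (let H = run \<mu> \<sigma> H0 k; u = \<mu> H; r = \<sigma> H u in succ_history H u r)"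

definition resulting_play ::
  "('d::finite) controller \<Rightarrow> 'd adversary \<Rightarrow> 'd history \<Rightarrow> 'd play" where
  "resulting_play \<mu> \<sigma> H0 k =
     (let H = run \<mu> \<sigma> H0 k; u = \<mu> H; r = \<sigma> H u in (H, u, r, run \<mu> \<sigma> H0 (Suc k)))"

lemma resulting_play_in_plays_from: "resulting_play \<mu> \<sigma> H0 \<in> plays_from H0"
  by (simp add: plays_from_def history_at_def resulting_play_def Let_def)

lemma run_in_histories: "H0 \<in> histories \<Longrightarrow> run \<mu> \<sigma> H0 k \<in> histories"
  by (induction k) (auto simp: histories_def succ_history_def Let_def split: prod.splits)

definition adversary_wins :: "('d::finite) history \<Rightarrow> 'd play set \<Rightarrow> bool" where
  "adversary_wins H0 T \<longleftrightarrow> (\<exists>\<sigma>. \<forall>\<mu>. resulting_play \<mu> \<sigma> H0 \<in> T)"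

definition escape_region :: "real \<Rightarrow> ('d::finite) history set" where
  "escape_region l = {H \<in> histories. adversary_wins H (Esc l H)}"

end

theory Submission
  imports Defs
begin

text \<open>
  If the adversary wins from \<open>H\<close>, it wins from every other history \<open>G\<close> by answering as if the new
  moves had been appended to \<open>H\<close>: since the next state \<open>u + r\<close> does not depend on the current one,
  the two plays append exactly the same states and responses. Their sets of state-response pairs
  differ by finitely many points (the old pairs, and the first new response, which is attached to
  the last old state). Neither the unboundedness of the states nor the finiteness of the envelope
  is affected by finitely many points.
\<close>

text \<open>Finiteness of the envelope as a property of an unordered set of pairs; \<open>B\<close>
  absorbs the positive part.\<close>

definition slack_bounded :: "real \<Rightarrow> ('a::real_normed_vector \<times> 'b::real_normed_vector) set \<Rightarrow> bool"
  where "slack_bounded l S \<longleftrightarrow>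
    (\<exists>B. \<forall>(x, r)\<in>S. \<forall>(x', r')\<in>S. norm (r - r') \<le> l * norm (x - x') + B)"

lemma slack_bounded_subset: "slack_bounded l T \<Longrightarrow> S \<subseteq> T \<Longrightarrow> slack_bounded l S"
  unfolding slack_bounded_def by blast

lemma slack_bounded_insert:
  assumes "l \<ge> 0" "slack_bounded l S"
  shows "slack_bounded l (insert p S)"
proof (cases "S = {}")
  case True
  then show ?thesis by (auto simp: slack_bounded_def)
next
  case False
  then obtain y t where yt: "(y, t) \<in> S" by auto
  obtain q s where p: "p = (q, s)" by fastforce
  from assms(2) obtain B where
    B: "\<And>x r x' r'. (x, r) \<in> S \<Longrightarrow> (x', r') \<in> S \<Longrightarrow> norm (r - r') \<le> l * norm (x - x') + B"
    unfolding slack_bounded_def by blast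
  define C where "C = norm (s - t) + l * norm (q - y) + B"
  have "B \<ge> 0" using B[OF yt yt] by simp
  with \<open>l \<ge> 0\<close> have C: "C \<ge> 0" "B \<le> C" by (auto simp: C_def)
  have new: "norm (s - r) \<le> l * norm (q - x) + C" if "(x, r) \<in> S" for x r
  proof -
    have "norm (s - r) \<le> norm (s - t) + norm (t - r)"
      using norm_triangle_ineq[of "s - t" "t - r"] by simp
    moreover have "norm (t - r) \<le> l * norm (y - x) + B" using B[OF yt that] .
    moreover have "norm (y - x) \<le> norm (q - y) + norm (q - x)"
      using norm_triangle_ineq[of "y - q" "q - x"] by (simp add: norm_minus_commute)
    then have "l * norm (y - x) \<le> l * norm (q - y) + l * norm (q - x)"
      using \<open>l \<ge> 0\<close> by (metis distrib_left mult_left_mono)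
    ultimately show ?thesis by (simp add: C_def)
  qed
  have "norm (r - r') \<le> l * norm (x - x') + C"
    if "(x, r) \<in> insert p S" "(x', r') \<in> insert p S" for x r x' r'
    using that new[of x r] new[of x' r'] B[of x r x' r'] C p
    by (auto simp: norm_minus_commute)
  then show ?thesis unfolding slack_bounded_def by blast
qed

lemma slack_bounded_Un_finite:
  assumes "finite F" "l \<ge> 0" "slack_bounded l S"
  shows "slack_bounded l (F \<union> S)"
  using assms by (induction F rule: finite_induct) (auto intro: slack_bounded_insert)

text \<open>\<open>zip\<close> drops the last state, which has not received a response yet.\<close>

definition answered :: "('d::finite) history \<Rightarrow> ((real ^ 'd) \<times> (real ^ 'd)) set" where
  "answered H = set (zip (fst H) (snd H))"

lemma rad_le_iff:
  assumes "H \<in> histories"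
  shows "rad H \<le> B \<longleftrightarrow> (\<forall>x\<in>set (fst H). dist (fst H ! 0) x \<le> B)"
  using assms
  by (auto simp: rad_def histories_def all_set_conv_all_nth less_Suc_eq_le dist_norm
      norm_minus_commute split: prod.splits)

text \<open>A nonnegative \<open>B\<close> bounds the positive part iff it bounds the difference
  itself, and it covers the value 0 given to a history without responses.\<close>

lemma Env_le_iff:
  assumes "H \<in> histories" "B \<ge> 0"
  shows "Env l H \<le> B \<longleftrightarrow>
    (\<forall>(x, r)\<in>answered H. \<forall>(x', r')\<in>answered H. norm (r - r') \<le> l * norm (x - x') + B)"
proof -
  obtain xs rs where H: "H = (xs, rs)" "length xs = Suc (length rs)"
    using assms by (auto simp: histories_def)
  have *: "answered H = (\<lambda>i. (xs ! i, rs ! i)) ` {0..<length rs}"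
    using H by (auto simp: answered_def set_zip)
  show ?thesis
    unfolding * using H assms(2) by (auto simp: Env_def algebra_simps)
qed

lemma Env_nonneg: "Env l H \<ge> 0"
proof -
  obtain xs rs where H: "H = (xs, rs)" by fastforce
  show ?thesis
    by (cases "length rs = 0") (auto simp: H Env_def Max_ge_iff)
qed

lemma SUP_ereal_eq_PInf_iff: "(SUP k. ereal (f k)) = \<infinity> \<longleftrightarrow> (\<nexists>B. \<forall>k. f k \<le> B)"
  for f :: "nat \<Rightarrow> real"
proof
  assume top: "(SUP k. ereal (f k)) = \<infinity>"
  show "\<nexists>B. \<forall>k. f k \<le> B"
  proof
    assume "\<exists>B. \<forall>k. f k \<le> B"
    then obtain B where "\<forall>k. f k \<le> B" ..
    then have "(SUP k. ereal (f k)) \<le> ereal B" by (intro SUP_least) simp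
    with top show False by simp
  qed
next
  assume unb: "\<nexists>B. \<forall>k. f k \<le> B"
  show "(SUP k. ereal (f k)) = \<infinity>"
  proof (rule SUP_PInfty)
    fix n :: nat
    show "\<exists>k\<in>UNIV. ereal (real n) \<le> ereal (f k)"
      using unb by (metis UNIV_I ereal_less_eq(3) linear)
  qed
qed

lemma run_prefix: "\<exists>vs ss. run \<mu> \<sigma> H k = (fst H @ vs, snd H @ ss)"
  by (induction k) (auto simp: succ_history_def Let_def prod_eq_iff)

text \<open>All histories of a run share the first state, so their radii are measured from one
  centre.\<close>

lemma bounded_states_iff:
  assumes "H \<in> histories"
  shows "bounded (\<Union>k. set (fst (run \<mu> \<sigma> H k))) \<longleftrightarrow> (\<exists>B. \<forall>k. rad (run \<mu> \<sigma> H k) \<le> B)"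
proof -
  have start: "fst (run \<mu> \<sigma> H k) ! 0 = fst H ! 0" for k
    using run_prefix[of \<mu> \<sigma> H k] assms by (auto simp: histories_def nth_append)
  show ?thesis
    unfolding bounded_any_center[where a = "fst H ! 0"]
    by (auto simp: rad_le_iff[OF run_in_histories[OF assms]] start)
qed

text \<open>The last state of \<open>K\<close> still awaits a response, so \<open>ss\<close> is
  paired with \<open>vs\<close> shifted by one place.\<close>

lemma answered_append:
  assumes "K \<in> histories"
  shows "answered (fst K @ vs, snd K @ ss) = answered K \<union> set (zip (last (fst K) # vs) ss)"
proof -
  obtain xs y rs where "K = (xs @ [y], rs)" "length xs = length rs"
    using assms by (cases K, cases "fst K" rule: rev_cases) (auto simp: histories_def)
  then show ?thesis by (simp add: answered_def zip_append1)
qed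

lemma answered_mono_run:
  assumes "H \<in> histories" "j \<le> k"
  shows "answered (run \<mu> \<sigma> H j) \<subseteq> answered (run \<mu> \<sigma> H k)"
proof (rule lift_Suc_mono_le[OF _ assms(2)])
  fix k
  show "answered (run \<mu> \<sigma> H k) \<subseteq> answered (run \<mu> \<sigma> H (Suc k))"
    unfolding run.simps Let_def succ_history_def answered_append[OF run_in_histories[OF assms(1)]]
    by (rule Un_upper1)
qed

lemma slack_bounded_answered_iff:
  assumes "H \<in> histories"
  shows "slack_bounded l (\<Union>k. answered (run \<mu> \<sigma> H k)) \<longleftrightarrow> (\<exists>B. \<forall>k. Env l (run \<mu> \<sigma> H k) \<le> B)"
    (is "slack_bounded l ?S \<longleftrightarrow> _")
proof
  assume "slack_bounded l ?S"
  then obtain B where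
    B: "\<forall>(x, r)\<in>?S. \<forall>(x', r')\<in>?S. norm (r - r') \<le> l * norm (x - x') + B"
    unfolding slack_bounded_def by blast
  \<comment> \<open>\<open>max B 0\<close> supplies the nonnegative bound that
    \<open>Env_le_iff\<close> asks for.\<close>
  have "Env l (run \<mu> \<sigma> H k) \<le> max B 0" for k
    unfolding Env_le_iff[OF run_in_histories[OF assms] max.cobounded2]
    using B by fastforce
  then show "\<exists>B. \<forall>k. Env l (run \<mu> \<sigma> H k) \<le> B" by blast
next
  assume "\<exists>B. \<forall>k. Env l (run \<mu> \<sigma> H k) \<le> B"
  then obtain B where B: "\<And>k. Env l (run \<mu> \<sigma> H k) \<le> B" by blast
  have "B \<ge> 0" using order_trans[OF Env_nonneg B] .
  have "norm (r - r') \<le> l * norm (x - x') + B"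
    if pts: "(x, r) \<in> ?S" "(x', r') \<in> ?S" for x r x' r'
  proof -
    obtain i j where "(x, r) \<in> answered (run \<mu> \<sigma> H i)" "(x', r') \<in> answered (run \<mu> \<sigma> H j)"
      using pts by (elim UN_E)
    \<comment> \<open>The two pairs may appear at different stages; the later stage contains
      both.\<close>
    then have "(x, r) \<in> answered (run \<mu> \<sigma> H (max i j))" "(x', r') \<in> answered (run \<mu> \<sigma> H (max i j))"
      using answered_mono_run[OF assms max.cobounded1] answered_mono_run[OF assms max.cobounded2]
      by (meson subsetD)+
    then show ?thesis
      using B[of "max i j", unfolded Env_le_iff[OF run_in_histories[OF assms] \<open>B \<ge> 0\<close>]] by fast
  qed
  then show "slack_bounded l ?S" unfolding slack_bounded_def by blast
qed

text \<open>Reduces the target to two sets in which neither order nor initial history is visible, so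
  that plays from different histories can be compared.\<close>

lemma resulting_play_in_Esc_iff:
  assumes "H \<in> histories"
  shows "resulting_play \<mu> \<sigma> H \<in> Esc l H \<longleftrightarrow>
    slack_bounded l (\<Union>k. answered (run \<mu> \<sigma> H k)) \<and> \<not> bounded (\<Union>k. set (fst (run \<mu> \<sigma> H k)))"
proof -
  have "history_at (resulting_play \<mu> \<sigma> H) k = run \<mu> \<sigma> H k" for k
    by (simp add: history_at_def resulting_play_def Let_def)
  moreover have "x < \<infinity> \<longleftrightarrow> x \<noteq> \<infinity>" for x :: ereal by simp
  ultimately show ?thesis
    unfolding bounded_states_iff[OF assms] slack_bounded_answered_iff[OF assms]
    using resulting_play_in_plays_from[of \<mu> \<sigma> H]
    by (simp only: Esc_def Env_inf_def mem_Collect_eq SUP_ereal_eq_PInf_iff not_not simp_thms)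
qed

text \<open>Meant for \<open>K\<close> extending \<open>A\<close>: what was played after
  \<open>A\<close> is moved onto \<open>B\<close>.\<close>

definition rebase :: "('d::finite) history \<Rightarrow> 'd history \<Rightarrow> 'd history \<Rightarrow> 'd history" where
  "rebase A B K =
     (fst B @ drop (length (fst A)) (fst K), snd B @ drop (length (snd A)) (snd K))"

lemma rebase_append: "rebase A B (fst A @ vs, snd A @ ss) = (fst B @ vs, snd B @ ss)"
  by (simp add: rebase_def)

text \<open>On each side one player sees the rebased history of the other side, so by induction both
  sides make the same moves. The last conclusion fixes the first response independently of
  \<open>k\<close>.\<close>

lemma run_rebase:
  obtains vs ss where
    "run (\<lambda>K. \<mu> (rebase H G K)) \<sigma> H k = (fst H @ vs, snd H @ ss)"
    "run \<mu> (\<lambda>K. \<sigma> (rebase G H K)) G k = (fst G @ vs, snd G @ ss)"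
    "ss = [] \<or> hd ss = \<sigma> H (\<mu> G)"
proof -
  have "\<exists>vs ss.
    run (\<lambda>K. \<mu> (rebase H G K)) \<sigma> H k = (fst H @ vs, snd H @ ss) \<and>
    run \<mu> (\<lambda>K. \<sigma> (rebase G H K)) G k = (fst G @ vs, snd G @ ss) \<and>
    length vs = length ss \<and> (ss = [] \<or> hd ss = \<sigma> H (\<mu> G))"
  proof (induction k)
    case 0
    show ?case by (intro exI[of _ "[]"]) simp
  next
    case (Suc k)
    then obtain vs ss where
      IH: "run (\<lambda>K. \<mu> (rebase H G K)) \<sigma> H k = (fst H @ vs, snd H @ ss)"
      "run \<mu> (\<lambda>K. \<sigma> (rebase G H K)) G k = (fst G @ vs, snd G @ ss)"
      "length vs = length ss" "ss = [] \<or> hd ss = \<sigma> H (\<mu> G)" by blast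
    let ?u = "\<mu> (fst G @ vs, snd G @ ss)"
    let ?r = "\<sigma> (fst H @ vs, snd H @ ss) ?u"
    \<comment> \<open>If \<open>ss\<close> is empty, the equal lengths make \<open>vs\<close> empty
      too, and \<open>?r\<close> is \<open>\<sigma> H (\<mu> G)\<close>.\<close>
    have "ss @ [?r] = [] \<or> hd (ss @ [?r]) = \<sigma> H (\<mu> G)"
      using IH(3,4) by (cases ss) auto
    then show ?case
      using IH
      by (intro exI[of _ "vs @ [?u + ?r]"] exI[of _ "ss @ [?r]"])
        (simp add: Let_def succ_history_def rebase_append)
  qed
  then show ?thesis using that by blast
qed

text \<open>The two shifted zips differ only in their head, where \<open>s\<close> is paired with
  the last state of \<open>G\<close> or of \<open>H\<close>.\<close>

lemma answered_append_subset:
  assumes "G \<in> histories" "H \<in> histories" "ss = [] \<or> hd ss = s"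
  shows "answered (fst G @ vs, snd G @ ss) \<subseteq>
    insert (last (fst G), s) (answered G) \<union> answered (fst H @ vs, snd H @ ss)"
  unfolding answered_append[OF assms(1)] answered_append[OF assms(2)]
  using assms(3) by (cases ss) auto

lemma adversary_wins_transfer:
  fixes G H :: "('d::finite) history"
  assumes "l \<ge> 0" and GH: "G \<in> histories" "H \<in> histories"
    and wins: "adversary_wins H (Esc l H)"
  shows "adversary_wins G (Esc l G)"
proof -
  obtain \<sigma> where \<sigma>: "\<And>\<mu>. resulting_play \<mu> \<sigma> H \<in> Esc l H"
    using wins unfolding adversary_wins_def by blast
  have "resulting_play \<mu> (\<lambda>K. \<sigma> (rebase G H K)) G \<in> Esc l G" for \<mu>
  proof -
    let ?RH = "run (\<lambda>K. \<mu> (rebase H G K)) \<sigma> H"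
    let ?RG = "run \<mu> (\<lambda>K. \<sigma> (rebase G H K)) G"
    \<comment> \<open>One finite set, independent of \<open>k\<close>, serves all stages.\<close>
    let ?F = "insert (last (fst G), \<sigma> H (\<mu> G)) (answered G)"
    have H_esc: "slack_bounded l (\<Union>k. answered (?RH k))" "\<not> bounded (\<Union>k. set (fst (?RH k)))"
      using \<sigma> resulting_play_in_Esc_iff[OF GH(2)] by blast+
    have "answered (?RG k) \<subseteq> ?F \<union> answered (?RH k)" for k
      by (rule run_rebase[of \<mu> H G \<sigma> k]) (simp only: answered_append_subset[OF GH])
    then have "(\<Union>k. answered (?RG k)) \<subseteq> ?F \<union> (\<Union>k. answered (?RH k))" by blast
    moreover have "finite ?F" by (simp add: answered_def)
    ultimately have env: "slack_bounded l (\<Union>k. answered (?RG k))"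
      using slack_bounded_Un_finite[OF _ \<open>l \<ge> 0\<close> H_esc(1)] slack_bounded_subset by blast
    \<comment> \<open>The inclusion runs opposite to the one for pairs: bounded states from
      \<open>G\<close> would bound those from \<open>H\<close>.\<close>
    have "set (fst (?RH k)) \<subseteq> set (fst H) \<union> set (fst (?RG k))" for k
      by (rule run_rebase[of \<mu> H G \<sigma> k]) auto
    then have "(\<Union>k. set (fst (?RH k))) \<subseteq> set (fst H) \<union> (\<Union>k. set (fst (?RG k)))" by blast
    then have "\<not> bounded (\<Union>k. set (fst (?RG k)))"
      using H_esc(2) bounded_subset bounded_Un finite_imp_bounded finite_set by metis
    with env show ?thesis using resulting_play_in_Esc_iff[OF GH(1)] by blast
  qed
  then show ?thesis unfolding adversary_wins_def by blast
qed

theorem proposition3p5: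
  fixes l :: real
  assumes "l \<ge> 0"
  shows "escape_region l = ({} :: ('d::finite) history set) \<or>
         escape_region l = (histories :: 'd history set)"
  using adversary_wins_transfer[OF assms] unfolding escape_region_def by blast

end
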